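(* Let $F$ be a Goldberg–Coxeter fullerene obtained from a fullerene $F_0$ by the Goldberg–Coxeter transformation $(k,l)$. Then the following hold. - The area of every facet of $F$ is an integer. - The square of every master edge of $F$ is an integer. - All these integers have the common factor $N_{kl}=k^2+kl+l^2$, the area scale factor of the transformation. Here the area of a facet with Coxeter coordinates $(k',l')$ and $(p,q)$ is $k'p+k'q+l'q$, and the square of a master edge with Coxeter coordinates $(a,b)$ is $a^2+ab+b^2$.
   Context: A fullerene is a 3-regular plane graph all of whose faces are pentagons or hexagons; there are exactly 12 pentagons. Its dual is a plane triangulation, which can be unfolded locally onto the Eisenstein plane. This is the complex plane with the triangular lattice $\{a+b\omega: a,b\in\mathbb{Z}\}$, where $\omega=e^{i\pi/3}$, so that $\omega^2=\omega-1$. The master polyhedron is the triangulated polyhedron whose vertices are the 12 pentagons. Its edges, the master edges, are lattice vectors $a+b\omega$ joining pentagon centers; their Coxeter coordinates are $(a,b)$ with $a,b\ge0$. Its triangular faces are called facets. A facet with two consecutive sides given by Coxeter coordinates $(k',l')$ and $(p,q)$ has side vectors $k'+l'\omega$ and $p\omega+q\omega^2=-q+(p+q)\omega$. Its (equivalent) area is the determinant $\det\begin{pmatrix}k'&l'\\-q&p+q\end{pmatrix}=k'p+k'q+l'q$. The area is normalized so that it counts carbon atoms, and the elementary patch $(1,0)$ has area $1$. The square of a master edge $(a,b)$ is $a^2+ab+b^2$, which is the area of the equilateral triangular patch having that edge. The Goldberg–Coxeter transformation $(k,l)$, with integers $k\ge1$ and $l\ge0$, multiplies every master edge vector by $k+l\omega$.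 Equivalently, it replaces each triangle of the dual by the graphene patch spanned by $k+l\omega$. A Goldberg–Coxeter fullerene is a fullerene obtained from some fullerene by a Goldberg–Coxeter transformation $(k,l)\neq(1,0)$. *)

theory Defs
  imports "HOL-Analysis.Analysis" "HOL-Combinatorics.Combinatorics"
begin

section \<open>Plane graphs and fullerenes\<close>

text \<open>
  A plane graph is given by its rotation system. A dart is an edge with a direction; \<open>opp\<close> reverses
  a dart and \<open>nxt\<close> turns it counterclockwise about its tail to the next dart with the same tail.
  The vertices, edges and faces are the orbits of \<open>nxt\<close>, \<open>opp\<close> and \<open>nxt \<circ> opp\<close>.
\<close>

record 'a dart_map =
  darts :: "'a set"
  opp :: "'a \<Rightarrow> 'a"
  nxt :: "'a \<Rightarrow> 'a"

definition vertex_orbit :: "'a dart_map \<Rightarrow> 'a \<Rightarrow> 'a set" where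
  "vertex_orbit G d = orbit (nxt G) d"

definition edge_orbit :: "'a dart_map \<Rightarrow> 'a \<Rightarrow> 'a set" where
  "edge_orbit G d = orbit (opp G) d"

definition face_orbit :: "'a dart_map \<Rightarrow> 'a \<Rightarrow> 'a set" where
  "face_orbit G d = orbit (nxt G \<circ> opp G) d"

text \<open>Planarity of the connected rotation system is Euler's formula.\<close>

definition connected_plane_map :: "'a dart_map \<Rightarrow> bool" where
  "connected_plane_map G \<longleftrightarrow>
     finite (darts G) \<and> darts G \<noteq> {} \<and>
     opp G permutes darts G \<and> nxt G permutes darts G \<and>
     (\<forall>d\<in>darts G. opp G d \<noteq> d \<and> opp G (opp G d) = d) \<and>
     (\<forall>d\<in>darts G. \<forall>d'\<in>darts G.
        (d, d') \<in> {(x, y). x \<in> darts G \<and> (y = opp G x \<or> y = nxt G x)}\<^sup>*) \<and>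
     int (card (vertex_orbit G ` darts G)) - int (card (edge_orbit G ` darts G))
       + int (card (face_orbit G ` darts G)) = 2"

definition simple_map :: "'a dart_map \<Rightarrow> bool" where
  "simple_map G \<longleftrightarrow>
     (\<forall>d\<in>darts G. opp G d \<notin> vertex_orbit G d) \<and>
     (\<forall>d\<in>darts G. \<forall>d'\<in>darts G.
        vertex_orbit G d = vertex_orbit G d' \<and> vertex_orbit G (opp G d) = vertex_orbit G (opp G d')
        \<longrightarrow> d = d')"

definition fullerene :: "'a dart_map \<Rightarrow> bool" where
  "fullerene G \<longleftrightarrow>
     connected_plane_map G \<and> simple_map G \<and>
     (\<forall>d\<in>darts G. card (vertex_orbit G d) = 3) \<and>
     (\<forall>d\<in>darts G. card (face_orbit G d) \<in> {5, 6})"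

section \<open>The Eisenstein plane\<close>

definition \<omega> :: complex where
  "\<omega> = cis (pi / 3)"

definition eisenstein :: "complex set" where
  "eisenstein = {of_int a + of_int b * \<omega> | a b :: int. True}"

text \<open>Real coordinates with respect to the basis \<open>1, \<omega>\<close>.\<close>

definition coord1 :: "complex \<Rightarrow> real" where
  "coord1 z = Re z - Im z / sqrt 3"

definition coord2 :: "complex \<Rightarrow> real" where
  "coord2 z = 2 * Im z / sqrt 3"

definition lattice_det :: "complex \<Rightarrow> complex \<Rightarrow> real" where
  "lattice_det z w = coord1 z * coord2 w - coord2 z * coord1 w"

definition edge_square :: "complex \<Rightarrow> real" where
  "edge_square z = (coord1 z)\<^sup>2 + coord1 z * coord2 z + (coord2 z)\<^sup>2"

definition area_scale :: "nat \<Rightarrow> nat \<Rightarrow> nat" where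
  "area_scale k l = k\<^sup>2 + k * l + l\<^sup>2"

text \<open>
  A lattice dart \<open>(p, u)\<close> is the unit lattice segment from \<open>p\<close> to \<open>p + u\<close>; the elementary triangle on
  its left is \<open>lattice_triangle (p, u)\<close>.
\<close>

type_synonym lattice_dart = "complex \<times> complex"

definition lattice_darts :: "lattice_dart set" where
  "lattice_darts = {(p, u). p \<in> eisenstein \<and> u ^ 6 = 1}"

fun lattice_opp :: "lattice_dart \<Rightarrow> lattice_dart" where
  "lattice_opp (p, u) = (p + u, - u)"

fun lattice_nxt :: "lattice_dart \<Rightarrow> lattice_dart" where
  "lattice_nxt (p, u) = (p + u, \<omega>\<^sup>2 * u)"

fun lattice_triangle :: "lattice_dart \<Rightarrow> complex set" where
  "lattice_triangle (p, u) = convex hull {p, p + u, p + \<omega> * u}"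

text \<open>The effect on lattice darts of the motion \<open>z \<mapsto> \<alpha> * z + \<beta>\<close>.\<close>

fun move :: "complex \<Rightarrow> complex \<Rightarrow> lattice_dart \<Rightarrow> lattice_dart" where
  "move \<alpha> \<beta> (p, u) = (\<alpha> * p + \<beta>, \<alpha> * u)"

text \<open>The lattice darts whose elementary triangle overlaps the region \<open>T\<close> in more than its boundary.\<close>

definition patch :: "complex set \<Rightarrow> lattice_dart set" where
  "patch T = {d \<in> lattice_darts. lattice_triangle d \<inter> interior T \<noteq> {}}"

section \<open>Unfolding the dual triangulation\<close>

text \<open>
  The dual triangulation of a cubic plane graph \<open>G\<close> has the same darts: the dual dart \<open>d\<close> crosses the
  dart \<open>d\<close> of \<open>G\<close> so that the tail of \<open>d\<close> lies on its left. The triangle to the left of a dual dart is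
  its \<open>nxt\<close>-orbit, in counterclockwise order, and the dual vertex from which it starts is the face
  \<open>face_orbit G d\<close>. On lattice darts the corresponding maps are \<open>lattice_opp\<close> and \<open>lattice_nxt\<close>, and
  \<open>lattice_nxt \<circ> lattice_opp\<close> is the clockwise rotation by \<open>pi / 3\<close> about the starting point.
  An unfolding of a region \<open>T\<close> labels the elementary triangles that \<open>T\<close> overlaps
  by triangles of the dual.
\<close>

definition unfolds :: "'a dart_map \<Rightarrow> complex set \<Rightarrow> (lattice_dart \<Rightarrow> 'a) \<Rightarrow> bool" where
  "unfolds G T h \<longleftrightarrow>
     (\<forall>d\<in>patch T. h d \<in> darts G \<and> h (lattice_nxt d) = nxt G (h d)) \<and>
     (\<forall>d\<in>patch T. lattice_opp d \<in> patch T \<longrightarrow> h (lattice_opp d) = opp G (h d))"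

section \<open>Master polyhedra\<close>

text \<open>
  A facet is a flat triangle on the surface of the dual, given by an unfolding. It has
  pentagon centers at its corners and nowhere else.
\<close>

record 'a facet =
  corner1 :: complex
  corner2 :: complex
  corner3 :: complex
  chart :: "lattice_dart \<Rightarrow> 'a"

definition facet_hull :: "'a facet \<Rightarrow> complex set" where
  "facet_hull f = convex hull {corner1 f, corner2 f, corner3 f}"

definition is_facet :: "'a dart_map \<Rightarrow> 'a facet \<Rightarrow> bool" where
  "is_facet G f \<longleftrightarrow>
     {corner1 f, corner2 f, corner3 f} \<subseteq> eisenstein \<and>
     lattice_det (corner2 f - corner1 f) (corner3 f - corner1 f) > 0 \<and>
     unfolds G (facet_hull f) (chart f) \<and>
     (\<forall>(p, u)\<in>patch (facet_hull f). p \<in> facet_hull f \<longrightarrow>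
        (card (face_orbit G (chart f (p, u))) = 5 \<longleftrightarrow> p \<in> {corner1 f, corner2 f, corner3 f}))"

text \<open>
  A point of the surface is described by a dart \<open>d\<close> and a point \<open>w\<close> of the elementary triangle
  with corners \<open>0, 1, \<omega>\<close>, in which \<open>d\<close> is the side from \<open>0\<close> to \<open>1\<close>. The facets of a master
  polyhedron cover every point of the surface and do not overlap. Since pentagon centers lie only at
  corners of facets, such a tiling is edge-to-edge, and its vertices are exactly the pentagon centers.
\<close>

definition master_polyhedron :: "'a dart_map \<Rightarrow> 'a facet set \<Rightarrow> bool" where
  "master_polyhedron G P \<longleftrightarrow>
     finite P \<and> (\<forall>f\<in>P. is_facet G f) \<and>
     (\<forall>d\<in>darts G. \<forall>w\<in>lattice_triangle (0, 1).
        \<exists>f\<in>P. \<exists>(p, u)\<in>patch (facet_hull f).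
          chart f (p, u) = d \<and> p + u * w \<in> facet_hull f) \<and>
     (\<forall>w\<in>interior (lattice_triangle (0, 1)). \<forall>f\<in>P. \<forall>f'\<in>P.
        \<forall>(p, u)\<in>patch (facet_hull f). \<forall>(p', u')\<in>patch (facet_hull f').
          chart f (p, u) = chart f' (p', u') \<and>
          p + u * w \<in> interior (facet_hull f) \<and> p' + u' * w \<in> interior (facet_hull f')
          \<longrightarrow> f = f' \<and> (p, u) = (p', u'))"

definition facet_edges :: "'a facet \<Rightarrow> complex set" where
  "facet_edges f =
     {corner2 f - corner1 f, corner3 f - corner2 f, corner1 f - corner3 f}"

definition master_edges :: "'a facet set \<Rightarrow> complex set" where
  "master_edges P = (\<Union>f\<in>P. facet_edges f)"

definition facet_area :: "'a facet \<Rightarrow> real" where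
  "facet_area f = lattice_det (corner2 f - corner1 f) (corner3 f - corner1 f)"

section \<open>The Goldberg-Coxeter transformation\<close>

text \<open>
  Every triangle of the dual of \<open>G\<close> is replaced by the patch with corners \<open>0, \<kappa>, \<kappa> * \<omega>\<close>, where
  \<open>\<kappa> = k + l * \<omega>\<close>. The copy with index \<open>x\<close> shows this patch with the dual dart \<open>x\<close> of \<open>G\<close>
  placed from \<open>0\<close> to \<open>\<kappa>\<close>.
\<close>

definition gc_vector :: "nat \<Rightarrow> nat \<Rightarrow> complex" where
  "gc_vector k l = of_nat k + of_nat l * \<omega>"

definition gc_patch :: "complex \<Rightarrow> lattice_dart set" where
  "gc_patch \<kappa> = patch (convex hull {0, \<kappa>, \<kappa> * \<omega>})"

definition gc_darts :: "'a dart_map \<Rightarrow> complex \<Rightarrow> ('a \<times> lattice_dart) set" where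
  "gc_darts G \<kappa> = darts G \<times> gc_patch \<kappa>"

text \<open>
  The first coordinate change is \<open>z \<mapsto> (z - \<kappa>) / \<omega>\<^sup>2\<close>, which passes between two views of
  the same patch. The second is \<open>z \<mapsto> \<kappa> - z\<close>, which passes to the patch on the other side
  of \<open>x\<close>; it identifies the two pieces of an elementary triangle that is cut by this side.
\<close>

definition gc_turn :: "complex \<Rightarrow> lattice_dart \<Rightarrow> lattice_dart" where
  "gc_turn \<kappa> = move (inverse (\<omega>\<^sup>2)) (- \<kappa> / \<omega>\<^sup>2)"

definition gc_cross :: "complex \<Rightarrow> lattice_dart \<Rightarrow> lattice_dart" where
  "gc_cross \<kappa> = move (- 1) \<kappa>"

definition gc_glue ::
    "'a dart_map \<Rightarrow> complex \<Rightarrow> (('a \<times> lattice_dart) \<times> ('a \<times> lattice_dart)) set" where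
  "gc_glue G \<kappa> =
     {((x, d), (nxt G x, gc_turn \<kappa> d)) | x d. x \<in> darts G \<and> d \<in> gc_patch \<kappa>} \<union>
     {((x, d), (opp G x, gc_cross \<kappa> d)) | x d.
        x \<in> darts G \<and> d \<in> gc_patch \<kappa> \<and> gc_cross \<kappa> d \<in> gc_patch \<kappa>}"

text \<open>Two elementary triangles are adjacent inside one patch or across a common side of two patches.\<close>

definition gc_adjacent ::
    "'a dart_map \<Rightarrow> complex \<Rightarrow> (('a \<times> lattice_dart) \<times> ('a \<times> lattice_dart)) set" where
  "gc_adjacent G \<kappa> =
     {((x, d), (x, lattice_opp d)) | x d.
        x \<in> darts G \<and> d \<in> gc_patch \<kappa> \<and> lattice_opp d \<in> gc_patch \<kappa>} \<union>
     {((x, d), (opp G x, gc_cross \<kappa> (lattice_opp d))) | x d.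
        x \<in> darts G \<and> d \<in> gc_patch \<kappa> \<and> gc_cross \<kappa> (lattice_opp d) \<in> gc_patch \<kappa>}"

text \<open>\<open>H\<close> is, up to renaming of darts, the result of gluing the patches along \<open>G\<close>.\<close>

definition goldberg_coxeter :: "nat \<Rightarrow> nat \<Rightarrow> 'a dart_map \<Rightarrow> 'b dart_map \<Rightarrow> bool" where
  "goldberg_coxeter k l G H \<longleftrightarrow>
     (let \<kappa> = gc_vector k l in
      \<exists>\<pi> :: 'a \<times> lattice_dart \<Rightarrow> 'b.
        \<pi> ` gc_darts G \<kappa> = darts H \<and>
        (\<forall>a\<in>gc_darts G \<kappa>. \<forall>b\<in>gc_darts G \<kappa>.
           \<pi> a = \<pi> b \<longleftrightarrow> (a, b) \<in> (gc_glue G \<kappa> \<union> (gc_glue G \<kappa>)\<inverse>)\<^sup>*) \<and>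
        (\<forall>(x, d)\<in>gc_darts G \<kappa>. nxt H (\<pi> (x, d)) = \<pi> (x, lattice_nxt d)) \<and>
        {(e, opp H e) | e. e \<in> darts H} = {(\<pi> a, \<pi> b) | a b. (a, b) \<in> gc_adjacent G \<kappa>})"

section \<open>Coxeter coordinates\<close>

lemma coord_Eisenstein [simp]:
  fixes a b :: real
  shows "coord1 (of_real a + of_real b * \<omega>) = a" "coord2 (of_real a + of_real b * \<omega>) = b"
proof -
  have re: "Re \<omega> = 1 / 2" and im: "Im \<omega> = sqrt 3 / 2"
    by (simp_all add: \<omega>_def cos_60 sin_60)
  show "coord1 (of_real a + of_real b * \<omega>) = a" "coord2 (of_real a + of_real b * \<omega>) = b"
    by (simp_all add: coord1_def coord2_def re im)
qed

lemma edge_square_eq_norm: "edge_square z = (cmod z)\<^sup>2"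
proof -
  have s: "sqrt 3 * sqrt 3 = (3 :: real)" by simp
  have "edge_square z = (Re z - Im z / sqrt 3)\<^sup>2 + (Re z - Im z / sqrt 3) * (2 * Im z / sqrt 3)
      + (2 * Im z / sqrt 3)\<^sup>2"
    by (simp add: edge_square_def coord1_def coord2_def)
  also have "\<dots> = (Re z)\<^sup>2 + 3 * (Im z)\<^sup>2 / (sqrt 3 * sqrt 3)"
    by (simp add: power2_eq_square field_simps)
  also have "\<dots> = (cmod z)\<^sup>2"
    by (simp add: s cmod_power2)
  finally show ?thesis .
qed

lemma lattice_det_eq_Im: "lattice_det z w = 2 / sqrt 3 * Im (cnj z * w)"
  by (simp add: lattice_det_def coord1_def coord2_def field_simps)

lemma cmod_root6: "cmod u = 1" if "u ^ 6 = 1" for u :: complex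
proof -
  have "cmod u ^ 6 = 1" using that by (metis norm_one norm_power)
  then show ?thesis using power_eq_imp_eq_base[of "cmod u" 6 1] by simp
qed

text \<open>The unit \<open>u\<close> accounts for the choice of the unfolding, which is determined up to rotation.\<close>

lemma edge_square_Coxeter:
  assumes "u ^ 6 = 1" and "z = u * (of_nat a + of_nat b * \<omega>)"
  shows "edge_square z = real (a\<^sup>2 + a * b + b\<^sup>2)"
proof -
  have "edge_square z = edge_square (of_nat a + of_nat b * \<omega>)"
    using assms by (simp add: edge_square_eq_norm norm_mult cmod_root6)
  then show ?thesis
    using coord_Eisenstein[of "real a" "real b"] by (simp add: edge_square_def)
qed

lemma facet_area_Coxeter:
  fixes k' l' p q :: nat
  assumes "u ^ 6 = 1"
    and "corner2 f - corner1 f = u * (of_nat k' + of_nat l' * \<omega>)"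
    and "corner3 f - corner1 f = u * (of_nat p * \<omega> + of_nat q * \<omega>\<^sup>2)"
  shows "facet_area f = real (k' * p + k' * q + l' * q)"
proof -
  have w2: "\<omega>\<^sup>2 = \<omega> - 1"
    by (simp add: \<omega>_def complex_eq_iff cos_60 sin_60 power2_eq_square)
  have v: "of_nat p * \<omega> + of_nat q * \<omega>\<^sup>2 = of_real (- real q) + of_real (real p + real q) * \<omega>"
    by (simp add: w2 algebra_simps)
  have "cnj u * u = 1"
    using cmod_root6[OF assms(1)] complex_norm_square[of u] by (simp add: mult.commute)
  then have rot: "cnj (u * x) * (u * y) = cnj x * y" for x y
    by (metis (no_types, lifting) complex_cnj_mult mult.assoc mult.left_commute mult.left_neutral)
  have "facet_area f = lattice_det (of_real (real k') + of_real (real l') * \<omega>)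
      (of_real (- real q) + of_real (real p + real q) * \<omega>)"
    unfolding facet_area_def assms(2,3) v lattice_det_eq_Im rot by simp
  also have "\<dots> = real k' * (real p + real q) - real l' * (- real q)"
    unfolding lattice_det_def coord_Eisenstein ..
  finally show ?thesis by (simp add: algebra_simps)
qed

end

theory Submission
  imports Defs
begin

text \<open>
  Let \<open>\<kappa> = k + l * \<omega>\<close>. Every dart of \<open>F\<close> comes from a lattice dart \<open>(p, u)\<close> in some copy of the
  patch, and \<open>p / u\<close> modulo \<open>\<kappa>\<close> does not depend on the copy. One step around a face multiplies this
  label by \<open>\<omega>\<close>, so a label at a pentagon satisfies \<open>(1 - \<omega> ^ 5) * r = 0\<close> modulo \<open>\<kappa>\<close>. As
  \<open>1 - \<omega> ^ 5\<close> is a unit, the label vanishes. In the chart of a facet, \<open>u * r - p\<close>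
  is constant modulo \<open>\<kappa>\<close>, hence any two corners differ by a multiple of \<open>\<kappa>\<close>, and squares and
  determinants of multiples of \<open>\<kappa>\<close> are divisible by \<open>\<kappa> * cnj \<kappa> = k\<^sup>2 + k * l + l\<^sup>2\<close>.
\<close>

section \<open>Eisenstein integers\<close>

lemma omega_sq: "\<omega> * \<omega> = \<omega> - 1"
  by (simp add: \<omega>_def complex_eq_iff cos_60 sin_60)

lemma omega_omega_mult: "\<omega> * (\<omega> * z) = \<omega> * z - z"
  by (simp only: mult.assoc[symmetric] omega_sq left_diff_distrib mult_1)

lemma omega_cube: "\<omega> ^ 3 = -1"
  by (simp add: power3_eq_cube omega_sq algebra_simps)

lemma omega_pow6: "\<omega> ^ 6 = 1"
  using power_mult[of \<omega> 3 2] by (simp add: omega_cube)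

lemma omega_nonzero [simp]: "\<omega> \<noteq> 0"
  using omega_pow6 by force

section \<open>Linearity and size of the lattice coordinates\<close>

lemma coord_add [simp]: "coord1 (z + w) = coord1 z + coord1 w" "coord2 (z + w) = coord2 z + coord2 w"
  by (simp_all add: coord1_def coord2_def field_simps)

lemma coord_uminus [simp]: "coord1 (- z) = - coord1 z" "coord2 (- z) = - coord2 z"
  by (simp_all add: coord1_def coord2_def)

lemma coord_diff [simp]: "coord1 (z - w) = coord1 z - coord1 w" "coord2 (z - w) = coord2 z - coord2 w"
  by (simp_all add: coord1_def coord2_def field_simps)

lemma coord_of_real_mult [simp]:
  "coord1 (of_real x * z) = x * coord1 z" "coord2 (of_real x * z) = x * coord2 z"
  by (simp_all add: coord1_def coord2_def field_simps)

lemma coord_0_1 [simp]: "coord1 0 = 0" "coord2 0 = 0" "coord1 1 = 1" "coord2 1 = 0"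
  by (simp_all add: coord1_def coord2_def)

lemma coord_of_real [simp]: "coord1 (of_real x) = x" "coord2 (of_real x) = 0"
  by (simp_all add: coord1_def coord2_def)

lemma coord_omega [simp]: "coord1 \<omega> = 0" "coord2 \<omega> = 1"
  using coord_Eisenstein[of 0 1] by simp_all

lemma coord_expand: "z = of_real (coord1 z) + of_real (coord2 z) * \<omega>"
  by (simp add: coord1_def coord2_def complex_eq_iff \<omega>_def cos_60 sin_60)

lemma coord_eqI: "coord1 z = coord1 w \<Longrightarrow> coord2 z = coord2 w \<Longrightarrow> z = w"
  by (metis coord_expand)

lemma coord_omega_mult [simp]:
  "coord1 (\<omega> * z) = - coord2 z" "coord2 (\<omega> * z) = coord1 z + coord2 z"
proof -
  have "\<omega> * z = of_real (- coord2 z) + of_real (coord1 z + coord2 z) * \<omega>"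
    by (subst coord_expand[of z]) (simp add: algebra_simps omega_omega_mult omega_sq)
  then show "coord1 (\<omega> * z) = - coord2 z" "coord2 (\<omega> * z) = coord1 z + coord2 z"
    by (metis coord_Eisenstein)+
qed

lemma continuous_coord [continuous_intros]:
  "continuous_on S f \<Longrightarrow> continuous_on S (\<lambda>z. coord1 (f z))"
  "continuous_on S f \<Longrightarrow> continuous_on S (\<lambda>z. coord2 (f z))"
  unfolding coord1_def coord2_def by (auto intro!: continuous_intros)

text \<open>The factor 2 is crude, but good enough both to count lattice points in a bounded set and
  to place a nearby point inside an elementary triangle.\<close>

lemma abs_coord_le: "\<bar>coord1 z\<bar> \<le> 2 * cmod z" "\<bar>coord2 z\<bar> \<le> 2 * cmod z"
proof -
  define t where "t = Im z / sqrt 3"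
  have "\<bar>t\<bar> * 1 \<le> \<bar>t\<bar> * sqrt 3"
    by (intro mult_left_mono) simp_all
  also have "\<dots> = \<bar>Im z\<bar>" by (simp add: t_def abs_mult)
  finally have "\<bar>t\<bar> \<le> cmod z" using abs_Im_le_cmod[of z] by linarith
  moreover have "coord1 z = Re z - t" "coord2 z = 2 * t"
    by (simp_all add: coord1_def coord2_def t_def)
  ultimately show "\<bar>coord1 z\<bar> \<le> 2 * cmod z" "\<bar>coord2 z\<bar> \<le> 2 * cmod z"
    using abs_Re_le_cmod[of z] by linarith+
qed

section \<open>The ring of Eisenstein integers, its units and its discreteness\<close>

lemma eisenstein_iff: "z \<in> eisenstein \<longleftrightarrow> coord1 z \<in> \<int> \<and> coord2 z \<in> \<int>"
proof
  assume "z \<in> eisenstein"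
  then obtain a b :: int where "z = of_real (of_int a) + of_real (of_int b) * \<omega>"
    by (auto simp: eisenstein_def)
  then show "coord1 z \<in> \<int> \<and> coord2 z \<in> \<int>"
    by (simp only: coord_Eisenstein) simp
next
  assume "coord1 z \<in> \<int> \<and> coord2 z \<in> \<int>"
  then obtain a b :: int where "coord1 z = of_int a" "coord2 z = of_int b"
    by (auto elim!: Ints_cases)
  then show "z \<in> eisenstein"
    unfolding eisenstein_def using coord_expand[of z] by auto
qed

lemma eisenstein_0 [simp]: "0 \<in> eisenstein"
  and eisenstein_1 [simp]: "1 \<in> eisenstein"
  and eisenstein_omega [simp]: "\<omega> \<in> eisenstein"
  by (simp_all add: eisenstein_iff)

lemma eisenstein_add [intro]: "z \<in> eisenstein \<Longrightarrow> w \<in> eisenstein \<Longrightarrow> z + w \<in> eisenstein"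
  and eisenstein_diff [intro]: "z \<in> eisenstein \<Longrightarrow> w \<in> eisenstein \<Longrightarrow> z - w \<in> eisenstein"
  and eisenstein_uminus [intro]: "z \<in> eisenstein \<Longrightarrow> - z \<in> eisenstein"
  by (simp_all add: eisenstein_iff)

lemma eisenstein_mult [intro]:
  assumes "z \<in> eisenstein" "w \<in> eisenstein"
  shows "z * w \<in> eisenstein"
proof -
  have "z * w = of_real (coord1 z) * w + of_real (coord2 z) * (\<omega> * w)"
    by (subst coord_expand[of z]) (simp add: algebra_simps)
  then show ?thesis
    using assms by (simp add: eisenstein_iff)
qed

text \<open>The polynomial \<open>u^6 - 1\<close> is the product of \<open>u^2 - 1\<close>,
  \<open>u^2 - u + 1\<close> and \<open>u^2 + u + 1\<close>, and both quadratics with nonreal roots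
  split over the Eisenstein integers. Hence sixth roots of unity and their inverses are Eisenstein
  units.\<close>

lemma root6_cases:
  fixes u :: complex
  assumes "u ^ 6 = 1"
  obtains "u = 1" | "u = \<omega>" | "u = \<omega> - 1" | "u = - 1" | "u = - \<omega>" | "u = 1 - \<omega>"
proof -
  have a: "(u - \<omega>) * (u - (1 - \<omega>)) = u * u - u + 1"
    using omega_sq by (simp add: algebra_simps)
  have b: "(u + \<omega>) * (u - (\<omega> - 1)) = u * u + u + 1"
    using omega_sq by (simp add: algebra_simps)
  have "(u - 1) * (u + 1) * ((u - \<omega>) * (u - (1 - \<omega>))) * ((u + \<omega>) * (u - (\<omega> - 1))) = u ^ 6 - 1"
    unfolding a b by (simp add: algebra_simps eval_nat_numeral)
  then have "(u - 1) * (u + 1) * ((u - \<omega>) * (u - (1 - \<omega>))) * ((u + \<omega>) * (u - (\<omega> - 1))) = 0"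
    using assms by simp
  then consider "u - 1 = 0" | "u + 1 = 0" | "u - \<omega> = 0" | "u - (1 - \<omega>) = 0" | "u + \<omega> = 0"
    | "u - (\<omega> - 1) = 0"
    by auto
  then show thesis
    using that by cases (simp_all add: eq_neg_iff_add_eq_0)
qed

lemma root6_eisenstein: "u ^ 6 = 1 \<Longrightarrow> u \<in> eisenstein"
  by (erule root6_cases) auto

lemma root6_inverse_eisenstein: "u ^ 6 = 1 \<Longrightarrow> inverse u \<in> eisenstein"
  by (simp add: root6_eisenstein power_inverse)

lemma countable_eisenstein: "countable eisenstein"
proof -
  have "eisenstein = (\<lambda>(a, b). of_int a + of_int b * \<omega>) ` (UNIV :: (int \<times> int) set)"
    by (auto simp: eisenstein_def)
  then show ?thesis by (metis countable_image countableI_type)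
qed

lemma finite_eisenstein_bounded:
  assumes "bounded S"
  shows "finite (eisenstein \<inter> S)"
proof -
  obtain B where B: "\<And>z. z \<in> S \<Longrightarrow> cmod z \<le> B"
    using assms unfolding bounded_iff by auto
  let ?I = "{- \<lceil>2 * B\<rceil>..\<lceil>2 * B\<rceil>}"
  have "eisenstein \<inter> S \<subseteq> (\<lambda>(a, b). of_int a + of_int b * \<omega>) ` (?I \<times> ?I)"
  proof
    fix z assume z: "z \<in> eisenstein \<inter> S"
    then obtain a b :: int where ab: "coord1 z = of_int a" "coord2 z = of_int b"
      by (auto simp: eisenstein_iff elim!: Ints_cases)
    have "\<bar>of_int a\<bar> \<le> 2 * B" "\<bar>of_int b\<bar> \<le> 2 * B"
      using abs_coord_le[of z] B[of z] z ab by auto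
    then have "a \<in> ?I" "b \<in> ?I"
      by (auto; linarith)+
    moreover have "z = of_int a + of_int b * \<omega>"
      using coord_expand[of z] ab by simp
    ultimately show "z \<in> (\<lambda>(a, b). of_int a + of_int b * \<omega>) ` (?I \<times> ?I)"
      by auto
  qed
  then show ?thesis
    by (rule finite_subset) auto
qed

section \<open>Triangles of the lattice\<close>

declare lattice_triangle.simps [simp del]

text \<open>Cramer's rule for \<open>w\<close> in the basis \<open>u, v\<close>, with the
  denominator multiplied out.\<close>

lemma lattice_det_expand:
  "lattice_det u v * coord1 w = lattice_det w v * coord1 u + lattice_det u w * coord1 v"
  "lattice_det u v * coord2 w = lattice_det w v * coord2 u + lattice_det u w * coord2 v"
  by (simp_all add: lattice_det_def algebra_simps)

text \<open>The barycentric coordinates \<open>x\<close> and \<open>y\<close> are continuous, so the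
  points where all three weights are positive form an open subset of the hull.\<close>

lemma interior_triangle_nonempty:
  assumes "lattice_det (b - a) (c - a) > 0"
  shows "interior (convex hull {a, b, c}) \<noteq> {}"
proof -
  define D where "D = lattice_det (b - a) (c - a)"
  define x where "x z = lattice_det (z - a) (c - a) / D" for z
  define y where "y z = lattice_det (b - a) (z - a) / D" for z
  define U where "U = {z. 0 < x z} \<inter> {z. 0 < y z} \<inter> {z. x z + y z < 1}"
  have D: "D > 0" using assms by (simp add: D_def)
  have cont: "continuous_on UNIV x" "continuous_on UNIV y"
    unfolding x_def y_def lattice_det_def using D by (auto intro!: continuous_intros)
  have "open U"
    unfolding U_def by (intro open_Int open_Collect_less continuous_intros cont)
  moreover have "U \<subseteq> convex hull {a, b, c}"
  proof
    fix z assume z: "z \<in> U"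
    have "coord1 (z - a) = x z * coord1 (b - a) + y z * coord1 (c - a)"
      "coord2 (z - a) = x z * coord2 (b - a) + y z * coord2 (c - a)"
      using lattice_det_expand[of "b - a" "c - a" "z - a"] D
      unfolding x_def y_def D_def[symmetric] by (simp_all add: field_simps del: coord_diff)
    then have "z = a + x z *\<^sub>R (b - a) + y z *\<^sub>R (c - a)"
      unfolding scaleR_conv_of_real
      by (intro coord_eqI) (simp_all only: coord_add coord_diff coord_of_real_mult)
    then show "z \<in> convex hull {a, b, c}"
      using z unfolding convex_hull_3_alt U_def by fastforce
  qed
  moreover have "\<exists>g. g \<in> U"
  proof
    \<comment> \<open>The centroid has all three barycentric weights equal to 1/3.\<close>
    define g where "g = a + of_real (1/3) * (b - a) + of_real (1/3) * (c - a)"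
    have "g - a = of_real (1/3) * (b - a) + of_real (1/3) * (c - a)" by (simp add: g_def)
    then have "lattice_det (g - a) (c - a) = D / 3" "lattice_det (b - a) (g - a) = D / 3"
      unfolding D_def lattice_det_def by (simp_all only: coord_add coord_of_real_mult) (simp_all add: field_simps)
    then have "x g = 1 / 3" "y g = 1 / 3" unfolding x_def y_def using D by simp_all
    then show "g \<in> U" by (simp add: U_def)
  qed
  ultimately show ?thesis
    by (metis empty_iff interior_maximal subsetD)
qed

lemma lattice_triangleI:
  assumes "0 \<le> x" "0 \<le> y" "x + y \<le> 1"
  shows "p + of_real x * u + of_real y * (\<omega> * u) \<in> lattice_triangle (p, u)"
  using assms unfolding lattice_triangle.simps convex_hull_3_alt scaleR_conv_of_real by force

text \<open>The step \<open>lattice_nxt\<close> permutes the three corners cyclically, because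
  \<open>1 + \<omega>\<^sup>2 = \<omega>\<close> and \<open>\<omega> ^ 3 = -1\<close>.\<close>

lemma lattice_triangle_nxt: "lattice_triangle (lattice_nxt d) = lattice_triangle d"
proof -
  obtain p u where d: "d = (p, u)" by (cases d)
  have "p + u + \<omega>\<^sup>2 * u = p + \<omega> * u" "p + u + \<omega> * (\<omega>\<^sup>2 * u) = p"
    by (simp_all add: power2_eq_square mult.assoc omega_omega_mult algebra_simps)
  then show ?thesis by (simp only: d lattice_nxt.simps lattice_triangle.simps insert_commute)
qed

text \<open>For directions 1 and -1 an elementary triangle is half of a unit cell in lattice
  coordinates. This turns incidence questions into linear arithmetic with integer corners.\<close>

lemma lattice_triangle_up:
  "z \<in> lattice_triangle (p, 1) \<longleftrightarrow>
    coord1 p \<le> coord1 z \<and> coord2 p \<le> coord2 z \<and> coord1 z + coord2 z \<le> coord1 p + coord2 p + 1"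
    (is "?L \<longleftrightarrow> ?R")
proof
  assume ?L
  then show ?R
    unfolding lattice_triangle.simps convex_hull_3_alt scaleR_conv_of_real by auto
next
  assume ?R
  moreover have "z = p + of_real (coord1 (z - p)) * 1 + of_real (coord2 (z - p)) * (\<omega> * 1)"
    by (metis add.assoc add.commute coord_expand diff_add_cancel mult.right_neutral)
  ultimately show ?L
    using lattice_triangleI[of "coord1 (z - p)" "coord2 (z - p)" p 1] by simp
qed

lemma lattice_triangle_down:
  "z \<in> lattice_triangle (p, -1) \<longleftrightarrow>
    coord1 z \<le> coord1 p \<and> coord2 z \<le> coord2 p \<and> coord1 p + coord2 p \<le> coord1 z + coord2 z + 1"
    (is "?L \<longleftrightarrow> ?R")
proof
  assume ?L
  then show ?R
    unfolding lattice_triangle.simps convex_hull_3_alt scaleR_conv_of_real by auto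
next
  assume ?R
  moreover have "z = p + of_real (coord1 (p - z)) * (-1) + of_real (coord2 (p - z)) * (\<omega> * (-1))"
    using coord_expand[of "p - z"] by (simp add: algebra_simps)
  ultimately show ?L
    using lattice_triangleI[of "coord1 (p - z)" "coord2 (p - z)" p "-1"] by simp
qed

lemma root6_rotate: "u ^ 6 = 1 \<Longrightarrow> (\<omega>\<^sup>2 * u) ^ 6 = 1"
  using power_mult[of \<omega> 6 2] by (simp add: power_mult_distrib omega_pow6)

text \<open>The numbers 1 and -1 represent the cosets of the subgroup generated by
  \<open>\<omega>\<^sup>2\<close> in the group of sixth roots of unity. So each triangle can be
  viewed from a side with direction 1 or -1.\<close>

lemma root6_rotate_sign:
  assumes "u ^ 6 = 1"
  shows "u \<in> {1, -1} \<or> \<omega>\<^sup>2 * u \<in> {1, -1} \<or> \<omega>\<^sup>2 * (\<omega>\<^sup>2 * u) \<in> {1, -1}"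
  using assms
  by (rule root6_cases; hypsubst)
    (simp_all add: omega_omega_mult omega_sq power2_eq_square algebra_simps)

lemma lattice_nxt_in: "d \<in> lattice_darts \<Longrightarrow> lattice_nxt d \<in> lattice_darts"
  by (cases d)
    (auto simp: lattice_darts_def root6_rotate root6_eisenstein)

lemma lattice_nxt_patch: "d \<in> patch T \<Longrightarrow> lattice_nxt d \<in> patch T"
  by (simp add: patch_def lattice_nxt_in lattice_triangle_nxt)

lemma lattice_triangle_cover: "\<exists>d\<in>lattice_darts. z \<in> lattice_triangle d"
proof -
  define p where "p = of_real \<lfloor>coord1 z\<rfloor> + of_real \<lfloor>coord2 z\<rfloor> * \<omega>"
  have p: "coord1 p = \<lfloor>coord1 z\<rfloor>" "coord2 p = \<lfloor>coord2 z\<rfloor>"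
    unfolding p_def by (simp_all only: coord_Eisenstein)
  have pE: "p \<in> eisenstein" by (simp add: eisenstein_iff p)
  show ?thesis
  proof (cases "coord1 z + coord2 z \<le> coord1 p + coord2 p + 1")
    case True
    then have "z \<in> lattice_triangle (p, 1)"
      by (simp add: lattice_triangle_up p)
    moreover have "(p, 1) \<in> lattice_darts"
      using pE by (simp add: lattice_darts_def)
    ultimately show ?thesis by blast
  next
    case False
    \<comment> \<open>The far half of the unit cell at \<open>p\<close> is the triangle seen from
      the opposite corner \<open>p + 1 + \<omega>\<close>.\<close>
    then have "z \<in> lattice_triangle (p + 1 + \<omega>, -1)"
      unfolding lattice_triangle_down using p by simp
    moreover have "(p + 1 + \<omega>, -1) \<in> lattice_darts"
      using pE by (simp add: lattice_darts_def eisenstein_iff)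
    ultimately show ?thesis by blast
  qed
qed

lemma lattice_triangle_interior:
  assumes "d \<in> lattice_darts"
  shows "interior (lattice_triangle d) \<noteq> {}"
proof -
  obtain p u where d: "d = (p, u)" by (cases d)
  have u: "u ^ 6 = 1" using assms by (simp add: d lattice_darts_def)
  have "lattice_det u (\<omega> * u) = edge_square u"
    by (simp add: lattice_det_def edge_square_def power2_eq_square algebra_simps)
  also have "\<dots> = 1" by (simp add: edge_square_eq_norm cmod_root6[OF u])
  finally show ?thesis
    using interior_triangle_nonempty[of "p + u" p "p + \<omega> * u"] by (simp add: d lattice_triangle.simps)
qed

text \<open>Each triangle that meets \<open>T\<close> starts at one of the finitely many lattice
  points near \<open>T\<close>, in one of six directions. Finiteness later makes a union of closed
  triangles closed.\<close>

lemma finite_patch: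
  assumes "bounded T"
  shows "finite (patch T)"
proof -
  obtain B where B: "\<And>z. z \<in> T \<Longrightarrow> cmod z \<le> B"
    using assms unfolding bounded_iff by auto
  have "patch T \<subseteq> (eisenstein \<inter> cball 0 (B + 2)) \<times> {1, \<omega>, \<omega> - 1, -1, -\<omega>, 1 - \<omega>}"
  proof
    fix d assume d: "d \<in> patch T"
    obtain p u where pu: "d = (p, u)" by (cases d)
    have u: "u ^ 6 = 1" and p: "p \<in> eisenstein"
      using d by (auto simp: pu patch_def lattice_darts_def)
    obtain z where z: "z \<in> lattice_triangle (p, u)" "z \<in> T"
      using d interior_subset by (auto simp: pu patch_def)
    have "lattice_triangle (p, u) \<subseteq> cball p 2"
      unfolding lattice_triangle.simps
      by (rule hull_minimal) (simp_all add: dist_norm norm_mult cmod_root6[OF u] cmod_root6[OF omega_pow6])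
    then have "cmod (p - z) \<le> 2" using z by (auto simp: dist_norm)
    then have "cmod p \<le> B + 2"
      using B[OF z(2)] norm_triangle_ineq2[of p z] by linarith
    moreover have "u \<in> {1, \<omega>, \<omega> - 1, -1, -\<omega>, 1 - \<omega>}"
      using u by (rule root6_cases) simp_all
    ultimately show "d \<in> (eisenstein \<inter> cball 0 (B + 2)) \<times> {1, \<omega>, \<omega> - 1, -1, -\<omega>, 1 - \<omega>}"
      using p by (simp add: pu)
  qed
  then show ?thesis
    by (rule finite_subset) (intro finite_cartesian_product finite_eisenstein_bounded; simp)
qed

text \<open>A point of a convex set with interior is a limit of interior points, and the six
  triangles around \<open>v\<close> cover a neighbourhood of \<open>v\<close>. This supplies a dart
  of the patch that starts at a given facet corner.\<close>

lemma patch_at_lattice_point: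
  assumes "convex T" "interior T \<noteq> {}" "v \<in> T" "v \<in> eisenstein"
  shows "\<exists>u. (v, u) \<in> patch T"
proof -
  have "v \<in> closure (interior T)"
    using convex_closure_interior[OF assms(1,2)] assms(3) closure_subset by blast
  \<comment> \<open>Distance below 1/4 bounds both lattice coordinates of \<open>z - v\<close> by
    1/2, so \<open>z\<close> does not leave the six triangles at \<open>v\<close>.\<close>
  then obtain z where z: "z \<in> interior T" "dist z v < 1/4"
    by (metis closure_approachable zero_less_divide_1_iff zero_less_numeral)
  define a b where "a = coord1 (z - v)" and "b = coord2 (z - v)"
  have "\<bar>a\<bar> \<le> 1/2" "\<bar>b\<bar> \<le> 1/2"
    using abs_coord_le[of "z - v"] z(2) unfolding a_def b_def dist_norm by linarith+
  then have ab: "a \<le> 1/2" "- a \<le> 1/2" "b \<le> 1/2" "- b \<le> 1/2"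
    by linarith+
  have sector: "\<exists>u. (v, u) \<in> patch T"
    if "u ^ 6 = 1" "0 \<le> x" "0 \<le> y" "x + y \<le> 1"
      "a = x * coord1 u - y * coord2 u" "b = x * coord2 u + y * (coord1 u + coord2 u)" for u x y
  proof -
    have "z = v + of_real x * u + of_real y * (\<omega> * u)"
      using that(5,6) by (intro coord_eqI) (simp_all add: a_def b_def)
    then have "z \<in> lattice_triangle (v, u)"
      using lattice_triangleI[OF that(2-4)] by simp
    then show ?thesis
      using z(1) that(1) assms(4) by (auto simp: patch_def lattice_darts_def)
  qed
  have w2: "(\<omega> - 1) ^ 6 = 1" "(1 - \<omega>) ^ 6 = 1" "(- \<omega>) ^ 6 = 1"
  proof -
    show "(\<omega> - 1) ^ 6 = 1"
      using root6_rotate[of 1] by (simp add: power2_eq_square omega_sq)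
    then show "(1 - \<omega>) ^ 6 = 1"
      by (metis minus_diff_eq power_minus_Bit0)
    show "(- \<omega>) ^ 6 = 1" by (simp add: omega_pow6)
  qed
  \<comment> \<open>The lines \<open>a = 0\<close>, \<open>b = 0\<close> and
    \<open>a + b = 0\<close> cut the plane into the six sectors spanned by \<open>u\<close> and
    \<open>\<omega> * u\<close>.\<close>
  have "(0 \<le> a \<and> 0 \<le> b) \<or> (a \<le> 0 \<and> 0 \<le> a + b) \<or> (a + b \<le> 0 \<and> 0 \<le> b) \<or>
      (a \<le> 0 \<and> b \<le> 0) \<or> (0 \<le> a \<and> a + b \<le> 0) \<or> (0 \<le> a + b \<and> b \<le> 0)"
    by linarith
  then consider "0 \<le> a" "0 \<le> b" | "a \<le> 0" "0 \<le> a + b" | "a + b \<le> 0" "0 \<le> b"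
    | "a \<le> 0" "b \<le> 0" | "0 \<le> a" "a + b \<le> 0" | "0 \<le> a + b" "b \<le> 0"
    by blast
  then show ?thesis
  proof cases
    case 1 then show ?thesis using ab by (intro sector[of 1 a b]) auto
  next
    case 2 then show ?thesis using ab omega_pow6 by (intro sector[of \<omega> "a + b" "- a"]) auto
  next
    case 3 then show ?thesis using ab w2 by (intro sector[of "\<omega> - 1" b "- a - b"]) auto
  next
    case 4 then show ?thesis using ab by (intro sector[of "-1" "- a" "- b"]) auto
  next
    case 5 then show ?thesis using ab w2 by (intro sector[of "- \<omega>" "- a - b" a]) auto
  next
    case 6 then show ?thesis using ab w2 by (intro sector[of "1 - \<omega>" "- b" "a + b"]) auto
  qed
qed

text \<open>Triangles that share only a corner are excluded, as their common point is a lattice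
  point. What remains is the same triangle, or an upward and a downward triangle with a common side;
  the three differences are the three possible sides.\<close>

lemma lattice_triangle_overlap:
  assumes z: "z \<in> lattice_triangle (q, s)" "z \<in> lattice_triangle (q', s')" "z \<notin> eisenstein"
    and q: "q \<in> eisenstein" "q' \<in> eisenstein" and s: "s \<in> {1, -1}" "s' \<in> {1, -1}"
  obtains "q = q'" "s = s'"
    | "s = 1" "s' = -1" "q' - q \<in> {1, \<omega>, 1 + \<omega>}"
    | "s = -1" "s' = 1" "q - q' \<in> {1, \<omega>, 1 + \<omega>}"
proof -
  have same: "q = q'"
    if h: "z \<in> lattice_triangle (q, s)" "z \<in> lattice_triangle (q', s)" "q \<in> eisenstein" "q' \<in> eisenstein"
      "s \<in> {1, -1}" for q q' s
  proof -
    obtain m n m' n' :: int where c: "coord1 q = m" "coord2 q = n" "coord1 q' = m'" "coord2 q' = n'"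
      using h(3,4) unfolding eisenstein_iff by (metis Ints_cases)
    have nz: "\<not> (coord1 z = of_int i \<and> coord2 z = of_int j)" for i j :: int
      using z(3) by (auto simp: eisenstein_iff)
    \<comment> \<open>Distinct translates of one triangle can touch only in a common corner, whose
      coordinates are \<open>m, n'\<close> or \<open>m', n\<close>.\<close>
    have "m = m' \<and> n = n'"
    proof (cases "s = 1")
      case True
      then show ?thesis
        using h(1,2) c nz[of m n'] nz[of m' n]
        unfolding True lattice_triangle_up by simp linarith
    next
      case False
      then have "s = -1" using h by simp
      then show ?thesis
        using h(1,2) c nz[of m n'] nz[of m' n]
        unfolding \<open>s = -1\<close> lattice_triangle_down by simp linarith
    qed
    then show ?thesis using c by (intro coord_eqI) simp_all
  qed
  have opposite: "q' - q \<in> {1, \<omega>, 1 + \<omega>}"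
    if h: "z \<in> lattice_triangle (q, 1)" "z \<in> lattice_triangle (q', -1)" "q \<in> eisenstein" "q' \<in> eisenstein"
    for q q'
  proof -
    obtain m n m' n' :: int where c: "coord1 q = m" "coord2 q = n" "coord1 q' = m'" "coord2 q' = n'"
      using h(3,4) unfolding eisenstein_iff by (metis Ints_cases)
    have nz: "\<not> (coord1 z = of_int i \<and> coord2 z = of_int j)" for i j :: int
      using z(3) by (auto simp: eisenstein_iff)
    \<comment> \<open>The lattice points excluded here are the three corners of the upward
      triangle.\<close>
    have "m' = m + 1 \<and> n' = n \<or> m' = m \<and> n' = n + 1 \<or> m' = m + 1 \<and> n' = n + 1"
      using h(1,2) c nz[of m n] nz[of "m + 1" n] nz[of m "n + 1"]
      unfolding lattice_triangle_up lattice_triangle_down by simp linarith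
    then have "q' - q = 1 \<or> q' - q = \<omega> \<or> q' - q = 1 + \<omega>"
      using c by (auto intro!: coord_eqI)
    then show ?thesis by simp
  qed
  show thesis
    using s that same[OF _ _ q s(1)] opposite[OF _ _ q] opposite[OF _ _ q(2,1)] z(1,2) by auto
qed

text \<open>
  Removing the countable set of lattice points leaves the interior of \<open>T\<close> connected, and two
  elementary triangles that meet in a point which is not a lattice point have a common side.
\<close>

context
  fixes T :: "complex set" and f :: "lattice_dart \<Rightarrow> 'b"
  assumes T: "convex T" "bounded T"
    and f_nxt: "\<And>d. d \<in> patch T \<Longrightarrow> f (lattice_nxt d) = f d"
    and f_opp: "\<And>d. d \<in> patch T \<Longrightarrow> lattice_opp d \<in> patch T \<Longrightarrow> f (lattice_opp d) = f d"
begin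

text \<open>At most two steps of \<open>lattice_nxt\<close> reach direction 1 or -1, and they change
  neither the triangle nor the value of \<open>f\<close>.\<close>

lemma patch_normalize:
  assumes "d \<in> patch T"
  obtains q s where "s \<in> {1, -1}" "(q, s) \<in> patch T" "f (q, s) = f d"
    "lattice_triangle (q, s) = lattice_triangle d"
proof -
  obtain p u where d: "d = (p, u)" by (cases d)
  let ?d1 = "lattice_nxt d" and ?d2 = "lattice_nxt (lattice_nxt d)"
  have p: "?d1 \<in> patch T" "?d2 \<in> patch T"
    using assms by (simp_all add: lattice_nxt_patch)
  have eq: "f ?d1 = f d" "f ?d2 = f d"
    using f_nxt p assms by simp_all
  have tri: "lattice_triangle ?d1 = lattice_triangle d" "lattice_triangle ?d2 = lattice_triangle d"
    by (simp_all only: lattice_triangle_nxt)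
  have "u ^ 6 = 1" using assms by (simp add: d patch_def lattice_darts_def)
  then have "snd d \<in> {1, -1} \<or> snd ?d1 \<in> {1, -1} \<or> snd ?d2 \<in> {1, -1}"
    using root6_rotate_sign by (simp add: d)
  then show thesis
    using that[of "snd d" "fst d"] that[of "snd ?d1" "fst ?d1"] that[of "snd ?d2" "fst ?d2"]
      assms p eq tri by (metis prod.collapse)
qed

text \<open>Each difference names one common side. Turning both triangles by
  \<open>lattice_nxt\<close> until their darts run along that side makes the two darts opposite to
  each other.\<close>

lemma patch_adjacent:
  assumes "(q, 1) \<in> patch T" "(q', -1) \<in> patch T" "q' - q \<in> {1, \<omega>, 1 + \<omega>}"
  shows "f (q, 1) = f (q', -1)"
proof -
  note w = omega_omega_mult omega_sq power2_eq_square algebra_simps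
  define n where "n = lattice_nxt"
  have np: "n d \<in> patch T" if "d \<in> patch T" for d
    using that by (simp add: n_def lattice_nxt_patch)
  have nf: "f (n d) = f d" if "d \<in> patch T" for d
    using that by (simp add: n_def f_nxt)
  consider "q' = q + 1" | "q' = q + \<omega>" | "q' = q + 1 + \<omega>"
    using assms(3) by (auto simp: algebra_simps)
  then show ?thesis
  proof cases
    case 1
    then have "lattice_opp (q, 1) = (q', -1)" by simp
    then show ?thesis using f_opp[of "(q, 1)"] assms by simp
  next
    case 2
    then have "lattice_opp (n (n (q, 1))) = n (n (q', -1))" by (simp add: n_def w)
    then show ?thesis
      using f_opp[of "n (n (q, 1))"] assms(1,2) by (simp add: np nf)
  next
    case 3
    then have "lattice_opp (n (q, 1)) = n (q', -1)" by (simp add: n_def w)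
    then show ?thesis
      using f_opp[of "n (q, 1)"] assms(1,2) by (simp add: np nf)
  qed
qed

lemma patch_overlap:
  assumes "d \<in> patch T" "d' \<in> patch T" "z \<in> lattice_triangle d" "z \<in> lattice_triangle d'"
    "z \<notin> eisenstein"
  shows "f d = f d'"
proof -
  obtain q s where 1: "s \<in> {1, -1}" "(q, s) \<in> patch T" "f (q, s) = f d"
      "lattice_triangle (q, s) = lattice_triangle d"
    using assms(1) by (rule patch_normalize)
  obtain q' s' where 2: "s' \<in> {1, -1}" "(q', s') \<in> patch T" "f (q', s') = f d'"
      "lattice_triangle (q', s') = lattice_triangle d'"
    using assms(2) by (rule patch_normalize)
  have q: "q \<in> eisenstein" "q' \<in> eisenstein"
    using 1 2 by (auto simp: patch_def lattice_darts_def)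
  have z: "z \<in> lattice_triangle (q, s)" "z \<in> lattice_triangle (q', s')"
    using 1(4) 2(4) assms(3,4) by simp_all
  show ?thesis
    using lattice_triangle_overlap[OF z assms(5) q 1(1) 2(1)]
  proof cases
    case 1
    then show ?thesis using \<open>f (q, s) = f d\<close> 2(3) by simp
  next
    case 2
    then show ?thesis using patch_adjacent[of q q'] 1(2,3) \<open>(q', s') \<in> patch T\<close> \<open>f (q', s') = f d'\<close>
      by simp
  next
    case 3
    then show ?thesis using patch_adjacent[of q' q] 1(2,3) 2(2,3) by simp
  qed
qed

text \<open>By \<open>patch_overlap\<close>, \<open>f\<close> induces a well-defined function
  \<open>g\<close> on the interior of \<open>T\<close> without its lattice points. This function is
  locally constant on a connected set, and every triangle of the patch contains a point of that
  set.\<close>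

lemma patch_constant:
  assumes "d \<in> patch T" "d' \<in> patch T"
  shows "f d = f d'"
proof -
  define S where "S = interior T - eisenstein"
  define g where "g z = f (SOME d. d \<in> patch T \<and> z \<in> lattice_triangle d)" for z
  have S_patch: "\<exists>d\<in>patch T. z \<in> lattice_triangle d" if "z \<in> S" for z
    using lattice_triangle_cover[of z] that by (auto simp: S_def patch_def)
  have g_eq: "g z = f d" if "z \<in> S" "d \<in> patch T" "z \<in> lattice_triangle d" for z d
  proof -
    define e where "e = (SOME d. d \<in> patch T \<and> z \<in> lattice_triangle d)"
    have "e \<in> patch T \<and> z \<in> lattice_triangle e"
      unfolding e_def by (rule someI_ex) (use that in blast)
    moreover have "z \<notin> eisenstein" using that(1) by (simp add: S_def)
    ultimately have "f e = f d" using patch_overlap[of e d z] that(2,3) by blast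
    then show ?thesis by (simp add: g_def e_def)
  qed
  have "connected S"
    unfolding S_def using T countable_eisenstein
    by (intro connected_open_diff_countable) (auto intro: convex_connected)
  have closed_tri: "closed (lattice_triangle d)" for d
    by (cases d) (simp add: lattice_triangle.simps compact_imp_closed finite_imp_compact_convex_hull)
  have g_const: "g x = g y" if "x \<in> S" "y \<in> S" for x y
  proof (rule connected_equivalence_relation[OF \<open>connected S\<close> that])
    fix z assume z: "z \<in> S"
    \<comment> \<open>Away from the closed set \<open>C\<close>, every patch triangle that contains
      \<open>x\<close> also contains \<open>z\<close>, so \<open>g\<close> takes the same value at
      both.\<close>
    define C where "C = \<Union> (lattice_triangle ` {d \<in> patch T. z \<notin> lattice_triangle d})"
    have "closed C"
      unfolding C_def using finite_patch[OF T(2)] closed_tri by (intro closed_UN) auto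
    then have "openin (top_of_set S) (S - C)"
      using openin_open_Int[of "- C" S] by (simp add: Diff_eq open_Compl)
    moreover have "z \<in> S - C" using z by (auto simp: C_def)
    moreover have "g z = g x" if x: "x \<in> S - C" for x
    proof -
      obtain d where d: "d \<in> patch T" "x \<in> lattice_triangle d" using S_patch x by blast
      then have "z \<in> lattice_triangle d" using x unfolding C_def by blast
      then show ?thesis using g_eq d z x by simp
    qed
    ultimately show "\<exists>U. openin (top_of_set S) U \<and> z \<in> U \<and> (\<forall>x\<in>U. g z = g x)"
      by blast
  qed auto
  \<comment> \<open>The point given by the definition of \<open>patch\<close> may be a lattice
    point. A triangle is the closure of its interior, so it overlaps \<open>interior T\<close> in an
    open set, which is not exhausted by countably many points.\<close>
  have meets: "\<exists>z\<in>S. z \<in> lattice_triangle d" if d: "d \<in> patch T" for d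
  proof -
    have ld: "d \<in> lattice_darts" and "lattice_triangle d \<inter> interior T \<noteq> {}"
      using d by (auto simp: patch_def)
    moreover have "convex (lattice_triangle d)" by (cases d) (simp add: lattice_triangle.simps)
    ultimately have "closure (interior (lattice_triangle d)) \<inter> interior T \<noteq> {}"
      using convex_closure_interior[of "lattice_triangle d"] lattice_triangle_interior[OF ld]
        closed_tri[of d] by simp
    then have ne: "interior T \<inter> interior (lattice_triangle d) \<noteq> {}"
      using open_Int_closure_eq_empty[of "interior T" "interior (lattice_triangle d)"] by auto
    then obtain z r where "r > 0" "ball z r \<subseteq> interior T \<inter> interior (lattice_triangle d)"
      by (metis ex_in_conv open_Int open_contains_ball open_interior)
    then have "interior T \<inter> interior (lattice_triangle d) - eisenstein \<noteq> {}"
      using ball_minus_countable_nonempty[OF countable_eisenstein, of r z] by blast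
    then show ?thesis
      using interior_subset[of "lattice_triangle d"] by (auto simp: S_def)
  qed
  obtain z z' where z: "z \<in> S" "z \<in> lattice_triangle d" "z' \<in> S" "z' \<in> lattice_triangle d'"
    using meets assms by blast
  have "f d = g z" using g_eq[OF z(1) assms(1) z(2)] by simp
  also have "g z = g z'" by (rule g_const[OF z(1,3)])
  also have "g z' = f d'" using g_eq[OF z(3) assms(2) z(4)] by simp
  finally show ?thesis .
qed

end

section \<open>Labels modulo the Goldberg-Coxeter vector\<close>

text \<open>The principal ideal of \<kappa> in the Eisenstein integers; congruence modulo \<kappa>
  means that the difference lies in it.\<close>

definition multiples :: "complex \<Rightarrow> complex set" where
  "multiples \<kappa> = (*) \<kappa> ` eisenstein"

lemma multiples_add: "z \<in> multiples \<kappa> \<Longrightarrow> w \<in> multiples \<kappa> \<Longrightarrow> z + w \<in> multiples \<kappa>"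
  unfolding multiples_def by (auto simp flip: distrib_left)

lemma multiples_mult: "a \<in> eisenstein \<Longrightarrow> z \<in> multiples \<kappa> \<Longrightarrow> a * z \<in> multiples \<kappa>"
  unfolding multiples_def by (auto simp: mult.left_commute)

lemma multiples_uminus: "z \<in> multiples \<kappa> \<Longrightarrow> - z \<in> multiples \<kappa>"
  using multiples_mult[of "-1" z \<kappa>] by (simp add: eisenstein_iff)

lemma multiples_diff: "z \<in> multiples \<kappa> \<Longrightarrow> w \<in> multiples \<kappa> \<Longrightarrow> z - w \<in> multiples \<kappa>"
  using multiples_add[OF _ multiples_uminus] by fastforce

lemma multiples_0: "0 \<in> multiples \<kappa>"
  unfolding multiples_def by force

section \<open>Positions of lattice darts up to rotation and modulo \<kappa>\<close>

lemma omega_inverse_sq: "inverse (\<omega>\<^sup>2) = - \<omega>"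
proof -
  have "\<omega>\<^sup>2 * - \<omega> = 1"
    using omega_cube by (simp add: power2_eq_square power3_eq_cube mult.assoc)
  then show ?thesis by (rule inverse_unique)
qed

text \<open>Under \<open>move \<alpha> \<beta>\<close> the factor \<alpha> cancels and the ratio
  changes by \<open>\<beta> / (\<alpha> * u)\<close>. For \<open>gc_turn\<close> and
  \<open>gc_cross\<close> this is \<kappa> times a unit, so the ratio modulo \<kappa> is the same in
  every view of a patch.\<close>

definition dart_ratio :: "lattice_dart \<Rightarrow> complex" where
  "dart_ratio d = fst d / snd d"

lemma dart_ratio_nxt:
  assumes "d \<in> lattice_darts"
  shows "dart_ratio (lattice_nxt d) = - \<omega> * (dart_ratio d + 1)"
proof -
  obtain p u where d: "d = (p, u)" by (cases d)
  have u: "u \<noteq> 0" using assms by (auto simp: d lattice_darts_def)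
  have "(p + u) / (\<omega>\<^sup>2 * u) = inverse (\<omega>\<^sup>2) * (p / u + 1)"
    using u by (simp add: field_simps)
  then show ?thesis unfolding omega_inverse_sq by (simp add: d dart_ratio_def)
qed

lemma dart_ratio_opp:
  assumes "d \<in> lattice_darts"
  shows "dart_ratio (lattice_opp d) = - (dart_ratio d + 1)"
proof -
  obtain p u where d: "d = (p, u)" by (cases d)
  have "u \<noteq> 0" using assms by (auto simp: d lattice_darts_def)
  then show ?thesis by (simp add: d dart_ratio_def field_simps)
qed

lemma dart_ratio_turn:
  assumes "d \<in> lattice_darts"
  shows "dart_ratio (gc_turn \<kappa> d) - dart_ratio d \<in> multiples \<kappa>"
proof -
  obtain p u where d: "d = (p, u)" by (cases d)
  have u: "u ^ 6 = 1" "u \<noteq> 0" using assms by (auto simp: d lattice_darts_def)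
  have "dart_ratio (gc_turn \<kappa> d) - dart_ratio d = \<kappa> * - inverse u"
    using u by (simp add: d gc_turn_def dart_ratio_def field_simps)
  then show ?thesis
    using eisenstein_uminus[OF root6_inverse_eisenstein[OF u(1)]] unfolding multiples_def by blast
qed

lemma dart_ratio_cross:
  assumes "d \<in> lattice_darts"
  shows "dart_ratio (gc_cross \<kappa> d) - dart_ratio d \<in> multiples \<kappa>"
proof -
  obtain p u where d: "d = (p, u)" by (cases d)
  have u: "u ^ 6 = 1" "u \<noteq> 0" using assms by (auto simp: d lattice_darts_def)
  have "dart_ratio (gc_cross \<kappa> d) - dart_ratio d = \<kappa> * - inverse u"
    using u by (simp add: d gc_cross_def dart_ratio_def field_simps)
  then show ?thesis
    using eisenstein_uminus[OF root6_inverse_eisenstein[OF u(1)]] unfolding multiples_def by blast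
qed

lemma gc_patch_lattice: "gc_patch \<kappa> \<subseteq> lattice_darts"
  by (auto simp: gc_patch_def patch_def)

lemma lattice_opp_in: "d \<in> lattice_darts \<Longrightarrow> lattice_opp d \<in> lattice_darts"
  by (cases d) (auto simp: lattice_darts_def root6_eisenstein)

text \<open>Each identification shifts the ratio by a multiple of \<kappa>, and these shifts may be
  added and negated along a chain.\<close>

lemma dart_ratio_glue:
  assumes "(a, b) \<in> (gc_glue G \<kappa> \<union> (gc_glue G \<kappa>)\<inverse>)\<^sup>*"
  shows "dart_ratio (snd a) - dart_ratio (snd b) \<in> multiples \<kappa>"
  using assms
proof (induction rule: rtrancl_induct)
  case base
  show ?case by (simp add: multiples_0)
next
  case (step b c)
  have *: "dart_ratio (snd y) - dart_ratio (snd x) \<in> multiples \<kappa>" if "(x, y) \<in> gc_glue G \<kappa>" for x y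
    using that dart_ratio_turn dart_ratio_cross gc_patch_lattice[of \<kappa>]
    by (auto simp: gc_glue_def)
  have "dart_ratio (snd b) - dart_ratio (snd c) \<in> multiples \<kappa>"
    using step.hyps(2) *[of b c] *[of c b] multiples_uminus[of _ \<kappa>] by fastforce
  with step.IH show ?case
    using multiples_add by fastforce
qed

text \<open>These are the rules for \<open>dart_ratio\<close> under \<open>lattice_nxt\<close> and
  \<open>lattice_opp\<close>, weakened to congruences because a dart of \<open>H\<close> determines
  its ratio only modulo \<kappa>.\<close>

definition gc_labelling :: "complex \<Rightarrow> 'b dart_map \<Rightarrow> ('b \<Rightarrow> complex) \<Rightarrow> bool" where
  "gc_labelling \<kappa> H r \<longleftrightarrow>
     (\<forall>e\<in>darts H. r (nxt H e) + \<omega> * (r e + 1) \<in> multiples \<kappa> \<and>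
        r (opp H e) + (r e + 1) \<in> multiples \<kappa>)"

lemma gc_labelling_exists:
  assumes gc: "goldberg_coxeter k l G H" and opp_G: "opp G permutes darts G"
  shows "\<exists>r. gc_labelling (gc_vector k l) H r"
proof -
  define \<kappa> where "\<kappa> = gc_vector k l"
  obtain \<pi> :: "'a \<times> lattice_dart \<Rightarrow> 'b" where
    im: "\<pi> ` gc_darts G \<kappa> = darts H" and
    eq: "\<forall>a\<in>gc_darts G \<kappa>. \<forall>b\<in>gc_darts G \<kappa>.
        \<pi> a = \<pi> b \<longleftrightarrow> (a, b) \<in> (gc_glue G \<kappa> \<union> (gc_glue G \<kappa>)\<inverse>)\<^sup>*" and
    nxt: "\<forall>(x, d)\<in>gc_darts G \<kappa>. nxt H (\<pi> (x, d)) = \<pi> (x, lattice_nxt d)" and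
    opp: "{(e, opp H e) | e. e \<in> darts H} = {(\<pi> a, \<pi> b) | a b. (a, b) \<in> gc_adjacent G \<kappa>}"
    using gc unfolding goldberg_coxeter_def Let_def \<kappa>_def[symmetric]
    by (elim exE conjE) (rule that)
  \<comment> \<open>An arbitrary preimage is chosen; \<open>dart_ratio_glue\<close> makes its
    residue class independent of the choice.\<close>
  define r where "r e = dart_ratio (snd (inv_into (gc_darts G \<kappa>) \<pi> e))" for e
  have r: "r (\<pi> a) - dart_ratio (snd a) \<in> multiples \<kappa>" if "a \<in> gc_darts G \<kappa>" for a
  proof -
    let ?b = "inv_into (gc_darts G \<kappa>) \<pi> (\<pi> a)"
    have "?b \<in> gc_darts G \<kappa>" "\<pi> ?b = \<pi> a"
      using inv_into_into[OF imageI[OF that]] f_inv_into_f[OF imageI[OF that]] .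
    then have "(?b, a) \<in> (gc_glue G \<kappa> \<union> (gc_glue G \<kappa>)\<inverse>)\<^sup>*"
      using eq that by blast
    then show ?thesis unfolding r_def by (rule dart_ratio_glue)
  qed
  have lat: "d \<in> lattice_darts" if "(x, d) \<in> gc_darts G \<kappa>" for x d
    using that gc_patch_lattice by (auto simp: gc_darts_def)
  have "r (nxt H e) + \<omega> * (r e + 1) \<in> multiples \<kappa>" if eH: "e \<in> darts H" for e
  proof -
    obtain x d where e: "e = \<pi> (x, d)" and xd: "(x, d) \<in> gc_darts G \<kappa>"
      using eH unfolding im[symmetric] by auto
    have "(x, lattice_nxt d) \<in> gc_darts G \<kappa>"
      using xd by (auto simp: gc_darts_def gc_patch_def lattice_nxt_patch)
    from r[OF this] have "r (nxt H e) + \<omega> * (dart_ratio d + 1) \<in> multiples \<kappa>"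
      using nxt xd by (auto simp: e dart_ratio_nxt[OF lat[OF xd]])
    from multiples_add[OF this multiples_mult[OF eisenstein_omega r[OF xd]]]
    show ?thesis by (simp add: e algebra_simps)
  qed
  moreover have "r (opp H e) + (r e + 1) \<in> multiples \<kappa>" if "e \<in> darts H" for e
  proof -
    have "(e, opp H e) \<in> {(\<pi> a, \<pi> b) | a b. (a, b) \<in> gc_adjacent G \<kappa>}"
      using that unfolding opp[symmetric] by blast
    then obtain a b where ab: "e = \<pi> a" "opp H e = \<pi> b" "(a, b) \<in> gc_adjacent G \<kappa>"
      by blast
    \<comment> \<open>Crossing a side leads to the copy with index \<open>opp G x\<close>, which is
      again a dart of \<open>G\<close>.\<close>
    then have mem: "a \<in> gc_darts G \<kappa>" "b \<in> gc_darts G \<kappa>"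
      using permutes_in_image[OF opp_G] by (auto simp: gc_adjacent_def gc_darts_def)
    have la: "snd a \<in> lattice_darts" using lat[of "fst a" "snd a"] mem(1) by simp
    have "snd b = lattice_opp (snd a) \<or> snd b = gc_cross \<kappa> (lattice_opp (snd a))"
      using ab(3) by (auto simp: gc_adjacent_def)
    then have "dart_ratio (snd b) - dart_ratio (lattice_opp (snd a)) \<in> multiples \<kappa>"
      using dart_ratio_cross[OF lattice_opp_in[OF la]] by (auto simp: multiples_0)
    from multiples_add[OF multiples_add[OF this r[OF mem(2)]] r[OF mem(1)]]
    show ?thesis
      unfolding ab(2) unfolding ab(1) by (simp add: dart_ratio_opp[OF la] algebra_simps)
  qed
  ultimately show ?thesis by (auto simp: gc_labelling_def \<kappa>_def)
qed

section \<open>Labels at pentagons\<close>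

lemma funpow_card_orbit:
  assumes "x \<in> orbit f x"
  shows "(f ^^ card (orbit f x)) x = x"
proof -
  \<comment> \<open>The iterates before the first return list the orbit without repetition.\<close>
  have "card (orbit f x) = funpow_dist1 f x x"
    using card_image[OF inj_on_funpow_dist1[OF assms]] orbit_conv_funpow_dist1[OF assms] by simp
  then show ?thesis using funpow_dist1_prop[OF assms] by simp
qed

text \<open>Five steps around the face return to \<open>e\<close> and multiply the label by
  \<open>\<omega> ^ 5\<close>, so \<kappa> divides
  \<open>(1 - \<omega> ^ 5) * r e = \<omega> * r e\<close>. Around a hexagon the factor is
  \<open>\<omega> ^ 6 = 1\<close>, which gives no constraint.\<close>

lemma pentagon_label:
  assumes r: "gc_labelling \<kappa> H r" and plane: "connected_plane_map H"
    and e: "e \<in> darts H" and pentagon: "card (face_orbit H e) = 5"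
  shows "r e \<in> multiples \<kappa>"
proof -
  let ?\<phi> = "nxt H \<circ> opp H"
  have perm: "opp H permutes darts H" "nxt H permutes darts H"
    using plane by (simp_all add: connected_plane_map_def)
  have step: "r (?\<phi> x) - \<omega> * r x \<in> multiples \<kappa>" "?\<phi> x \<in> darts H" if x: "x \<in> darts H" for x
  proof -
    have y: "opp H x \<in> darts H" using x perm(1) by (simp add: permutes_in_image)
    then show "?\<phi> x \<in> darts H" using perm(2) by (simp add: permutes_in_image)
    have 1: "r (?\<phi> x) + \<omega> * (r (opp H x) + 1) \<in> multiples \<kappa>"
      and 2: "r (opp H x) + (r x + 1) \<in> multiples \<kappa>"
      using r x y by (auto simp: gc_labelling_def)
    \<comment> \<open>Subtracting \<omega> times the rule for \<open>opp\<close> from the rule for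
      \<open>nxt\<close> eliminates the label of the intermediate dart.\<close>
    from multiples_diff[OF 1 multiples_mult[OF eisenstein_omega 2]]
    show "r (?\<phi> x) - \<omega> * r x \<in> multiples \<kappa>" by (simp add: algebra_simps)
  qed
  have iter: "(?\<phi> ^^ n) e \<in> darts H \<and> r ((?\<phi> ^^ n) e) - \<omega> ^ n * r e \<in> multiples \<kappa>" for n
  proof (induction n)
    case 0
    then show ?case using e by (simp add: multiples_0)
  next
    case (Suc n)
    define x where "x = (?\<phi> ^^ n) e"
    have x: "x \<in> darts H" "r x - \<omega> ^ n * r e \<in> multiples \<kappa>"
      using Suc.IH by (simp_all only: x_def)
    have "(?\<phi> ^^ Suc n) e = ?\<phi> x" by (simp add: x_def)
    moreover have "r (?\<phi> x) - \<omega> ^ Suc n * r e \<in> multiples \<kappa>"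
      using multiples_add[OF step(1)[OF x(1)] multiples_mult[OF eisenstein_omega x(2)]]
      by (simp add: algebra_simps)
    ultimately show ?case using step(2)[OF x(1)] by (simp only:)
  qed
  have "?\<phi> permutes darts H" using perm by (intro permutes_compose)
  \<comment> \<open>An \<open>orbit\<close> starts with the first image, so membership of
    \<open>e\<close> itself uses that a permutation of a finite set returns.\<close>
  then have "e \<in> orbit ?\<phi> e"
    using plane by (intro permutation_self_in_orbit permutation_permutes[THEN iffD2])
      (auto simp: connected_plane_map_def)
  then have "(?\<phi> ^^ 5) e = e"
    using funpow_card_orbit[of e ?\<phi>] pentagon by (simp only: face_orbit_def)
  then have "r e - \<omega> ^ 5 * r e \<in> multiples \<kappa>" using iter[of 5] by simp
  moreover have "\<omega> ^ 5 = 1 - \<omega>"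
    by (simp add: eval_nat_numeral omega_omega_mult omega_sq algebra_simps)
  ultimately have "\<omega> * r e \<in> multiples \<kappa>" by (simp add: algebra_simps)
  from multiples_mult[OF root6_inverse_eisenstein[OF omega_pow6] this]
  show ?thesis by (simp flip: mult.assoc)
qed

text \<open>The chart and the labelling measure positions in frames that differ by a rotation and a
  translation. The translation is constant modulo \<kappa> on the facet, and each pentagon corner
  determines it.\<close>

lemma facet_corners_congruent:
  assumes facet: "is_facet H f" and r: "gc_labelling \<kappa> H r"
    and plane: "connected_plane_map H"
    and v: "v \<in> {corner1 f, corner2 f, corner3 f}" "w \<in> {corner1 f, corner2 f, corner3 f}"
  shows "v - w \<in> multiples \<kappa>"
proof -
  define T where "T = facet_hull f"
  define h where "h = chart f"
  have h_dart: "h d \<in> darts H" and h_nxt: "h (lattice_nxt d) = nxt H (h d)" if "d \<in> patch T" for d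
    using facet that by (auto simp: is_facet_def unfolds_def T_def h_def)
  have h_opp: "h (lattice_opp d) = opp H (h d)" if "d \<in> patch T" "lattice_opp d \<in> patch T" for d
    using facet that by (auto simp: is_facet_def unfolds_def T_def h_def)
  \<comment> \<open>With \<open>d = (p, u)\<close>, \<open>u * r (h d)\<close> is the label rotated
    into the frame of the chart, and \<open>c d\<close> is the offset from the charted position
    \<open>p\<close>.\<close>
  define c where "c d = snd d * r (h d) - fst d" for d
  \<comment> \<open>Residue classes taken as sets turn congruence of offsets into the equality that
    \<open>patch_constant\<close> asks for.\<close>
  define C where "C d = {z. z - c d \<in> multiples \<kappa>}" for d
  have C_eq: "C d = C d'" if "c d - c d' \<in> multiples \<kappa>" for d d'
    using multiples_add[OF _ that] multiples_diff[OF _ that] unfolding C_def by fastforce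
  have "convex T" "bounded T"
    by (simp_all add: T_def facet_hull_def bounded_convex_hull finite_imp_bounded)
  have C_const: "C d = C d'" if "d \<in> patch T" "d' \<in> patch T" for d d'
  proof (rule patch_constant[OF \<open>convex T\<close> \<open>bounded T\<close> _ _ that])
    fix d assume d: "d \<in> patch T"
    obtain p u where pu: "d = (p, u)" by (cases d)
    have u: "u ^ 6 = 1" using d by (simp add: pu patch_def lattice_darts_def)
    \<comment> \<open>Since \<open>\<omega> ^ 3 = -1\<close>, the second summand contributes
      \<open>- u * (r (h d) + 1)\<close>.\<close>
    have "c (lattice_nxt d) - c d = \<omega>\<^sup>2 * u * (r (nxt H (h d)) + \<omega> * (r (h d) + 1))"
      using omega_cube by (simp add: c_def h_nxt[OF d]) (simp add: pu algebra_simps power2_eq_square power3_eq_cube omega_omega_mult)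
    moreover have "\<dots> \<in> multiples \<kappa>"
      using r h_dart[OF d] root6_eisenstein[OF root6_rotate[OF u]]
      by (intro multiples_mult) (auto simp: gc_labelling_def)
    ultimately show "C (lattice_nxt d) = C d" by (intro C_eq) simp
    assume d': "lattice_opp d \<in> patch T"
    have "c (lattice_opp d) - c d = - u * (r (opp H (h d)) + (r (h d) + 1))"
      by (simp add: c_def h_opp[OF d d']) (simp add: pu algebra_simps)
    moreover have "\<dots> \<in> multiples \<kappa>"
      using r h_dart[OF d] root6_eisenstein[OF u]
      by (intro multiples_mult) (auto simp: gc_labelling_def)
    ultimately show "C (lattice_opp d) = C d" by (intro C_eq) simp
  qed
  \<comment> \<open>At a corner the label is divisible by \<kappa>, which leaves \<open>c d\<close>
    congruent to \<open>- x\<close>.\<close>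
  have corner: "\<exists>d\<in>patch T. c d + x \<in> multiples \<kappa>" if x: "x \<in> {corner1 f, corner2 f, corner3 f}" for x
  proof -
    have xT: "x \<in> T" unfolding T_def facet_hull_def by (rule hull_inc[OF x])
    have "interior T \<noteq> {}"
      using facet interior_triangle_nonempty by (simp add: is_facet_def T_def facet_hull_def)
    moreover have "x \<in> eisenstein" using facet x by (auto simp: is_facet_def)
    ultimately obtain u where u: "(x, u) \<in> patch T"
      using patch_at_lattice_point[OF \<open>convex T\<close> _ xT] by blast
    have "card (face_orbit H (h (x, u))) = 5"
      using facet u x xT unfolding is_facet_def T_def h_def by blast
    then have "r (h (x, u)) \<in> multiples \<kappa>"
      using pentagon_label[OF r plane h_dart[OF u]] by simp
    then have "u * r (h (x, u)) \<in> multiples \<kappa>"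
      using u by (intro multiples_mult root6_eisenstein) (auto simp: patch_def lattice_darts_def)
    then show ?thesis using u by (intro bexI[of _ "(x, u)"]) (simp_all add: c_def)
  qed
  obtain d d' where d: "d \<in> patch T" "c d + v \<in> multiples \<kappa>" "d' \<in> patch T" "c d' + w \<in> multiples \<kappa>"
    using corner v by meson
  have "c d \<in> C d'" using C_const[OF d(1,3)] by (auto simp: C_def multiples_0)
  then have "c d - c d' \<in> multiples \<kappa>" by (simp add: C_def)
  from multiples_diff[OF multiples_diff[OF d(2,4)] this]
  show ?thesis by (simp add: algebra_simps)
qed

section \<open>Divisibility of squares and determinants by the norm of \<kappa>\<close>

lemma edge_square_gc_vector: "edge_square (gc_vector k l) = area_scale k l"
  using coord_Eisenstein[of "real k" "real l"]
  by (simp add: edge_square_def gc_vector_def area_scale_def)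

text \<open>The edge square is the squared modulus, hence multiplicative, and it is an integer on
  the Eisenstein cofactor.\<close>

lemma edge_square_multiple:
  assumes "z \<in> multiples (gc_vector k l)"
  shows "\<exists>n :: int. edge_square z = of_int n \<and> int (area_scale k l) dvd n"
proof -
  obtain w where w: "z = gc_vector k l * w" "w \<in> eisenstein"
    using assms by (auto simp: multiples_def)
  obtain a b :: int where "coord1 w = of_int a" "coord2 w = of_int b"
    using w(2) unfolding eisenstein_iff by (metis Ints_cases)
  then have "edge_square w = of_int (a\<^sup>2 + a * b + b\<^sup>2)" by (simp add: edge_square_def)
  moreover have "edge_square z = edge_square (gc_vector k l) * edge_square w"
    by (simp add: w(1) edge_square_eq_norm norm_mult power_mult_distrib)
  ultimately have "edge_square z = of_int (int (area_scale k l) * (a\<^sup>2 + a * b + b\<^sup>2))"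
    by (simp add: edge_square_gc_vector)
  then show ?thesis by (metis dvd_triv_left)
qed

text \<open>The determinant is a constant times \<open>Im (cnj z * z')\<close>, so a common factor
  \<kappa> of \<open>z\<close> and \<open>z'\<close> comes out as the real number
  \<open>\<kappa> * cnj \<kappa>\<close>.\<close>

lemma lattice_det_multiple:
  assumes "z \<in> multiples (gc_vector k l)" "z' \<in> multiples (gc_vector k l)"
  shows "\<exists>n :: int. lattice_det z z' = of_int n \<and> int (area_scale k l) dvd n"
proof -
  let ?\<kappa> = "gc_vector k l"
  obtain w w' where w: "z = ?\<kappa> * w" "w \<in> eisenstein" "z' = ?\<kappa> * w'" "w' \<in> eisenstein"
    using assms by (auto simp: multiples_def)
  obtain a b a' b' :: int where "coord1 w = of_int a" "coord2 w = of_int b"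
      "coord1 w' = of_int a'" "coord2 w' = of_int b'"
    using w(2,4) unfolding eisenstein_iff by (metis Ints_cases)
  then have "lattice_det w w' = of_int (a * b' - b * a')" by (simp add: lattice_det_def)
  moreover have "lattice_det z z' = edge_square ?\<kappa> * lattice_det w w'"
  proof -
    have "cnj z * z' = of_real (edge_square ?\<kappa>) * (cnj w * w')"
      by (simp add: w edge_square_eq_norm complex_norm_square[symmetric] algebra_simps
          flip: complex_norm_square)
    then show ?thesis by (simp add: lattice_det_eq_Im)
  qed
  ultimately have "lattice_det z z' = of_int (int (area_scale k l) * (a * b' - b * a'))"
    by (simp add: edge_square_gc_vector)
  then show ?thesis by (metis dvd_triv_left)
qed

theorem theorem3:
  fixes F0 :: "'a dart_map" and F :: "'b dart_map"
    and P :: "'b facet set" and k l :: nat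
  assumes "fullerene F0" and "fullerene F"
    and "k \<ge> 1" and "(k, l) \<noteq> (1, 0)"
    and "goldberg_coxeter k l F0 F"
    and "master_polyhedron F P"
  shows "(\<forall>f\<in>P. facet_area f \<in> \<int>) \<and>
    (\<forall>z\<in>master_edges P. edge_square z \<in> \<int>) \<and>
    (\<forall>f\<in>P. \<exists>n :: int. facet_area f = of_int n \<and> int (area_scale k l) dvd n) \<and>
    (\<forall>z\<in>master_edges P. \<exists>n :: int. edge_square z = of_int n \<and> int (area_scale k l) dvd n)"
proof -
  have perm0: "opp F0 permutes darts F0" and plane: "connected_plane_map F"
    using assms(1,2) by (simp_all add: fullerene_def connected_plane_map_def)
  obtain r where r: "gc_labelling (gc_vector k l) F r"
    using gc_labelling_exists[OF assms(5) perm0] by blast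
  \<comment> \<open>Side vectors of facets are differences of corners, so this one fact serves areas
    and edges alike.\<close>
  have mult: "v - w \<in> multiples (gc_vector k l)"
    if "f \<in> P" "v \<in> {corner1 f, corner2 f, corner3 f}" "w \<in> {corner1 f, corner2 f, corner3 f}" for f v w
    using facet_corners_congruent[OF _ r plane that(2,3)] assms(6) that(1)
    by (simp add: master_polyhedron_def)
  have area: "\<exists>n :: int. facet_area f = of_int n \<and> int (area_scale k l) dvd n" if "f \<in> P" for f
    unfolding facet_area_def using mult[OF that] by (intro lattice_det_multiple) auto
  have edge: "\<exists>n :: int. edge_square z = of_int n \<and> int (area_scale k l) dvd n"
    if z: "z \<in> master_edges P" for z
  proof (rule edge_square_multiple)
    obtain f where "f \<in> P" "z \<in> facet_edges f" using z by (auto simp: master_edges_def)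
    then show "z \<in> multiples (gc_vector k l)"
      using mult[of f] by (auto simp: facet_edges_def)
  qed
  have "\<forall>f\<in>P. facet_area f \<in> \<int>" using area by (metis Ints_of_int)
  moreover have "\<forall>z\<in>master_edges P. edge_square z \<in> \<int>" using edge by (metis Ints_of_int)
  ultimately show ?thesis using area edge by blast
qed

end
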